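(* Let $1\le n\le m$ be integers. Then $\mathsf P_{n,m}$ is normally equivalent to a matroid polytope if and only if $n=1$ and $m\in\{1,2\}$. If moreover $(n,m)\ne(1,1)$, then $\mathsf Q_{n,m}$ is normally equivalent to a matroid polytope if and only if $n=1$ and $m\in\{2,3\}$.
   Context: Let $K_{n,m}$ be the complete bipartite graph with nodes $a_1,\dots,a_n,b_1,\dots,b_m$ and arcs $a_ib_j$. Let $\mathbb R^{n+m}$ have coordinates and standard basis vectors labeled by these nodes. Its graphical zonotope is the Minkowski sum of segments $\mathsf Z_{n,m}=\sum_{i=1}^n\sum_{j=1}^m[e_{a_i},e_{b_j}]\subset\mathbb R^{n+m}$. Define $$\mathsf P_{n,m}=\mathsf Z_{n,m}\cap\Big\{x:\sum_{j=1}^m x_{b_j}\le nm-1\Big\},\qquad \mathsf Q_{n,m}=\mathsf P_{n,m}\cap\Big\{x:\sum_{i=1}^n x_{a_i}\le nm-1\Big\}.$$ Two polytopes in the same space are normally equivalent if they have the same normal fan. The matroid polytope of a matroid $M$ with ground set $S$ is $\mathrm{conv}\{\sum_{x\in B}e_x: B\text{ a basis of }M\}\subset\mathbb R^S$ (here $S$ is the set of the $n+m$ coordinate labels). *)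

theory Defs
  imports "HOL-Analysis.Analysis"
begin

text \<open>
  The nodes $a_i$ and $b_j$ of $K_{n,m}$ are \<open>Inl i\<close> and \<open>Inr j\<close>, with \<open>i\<close> and \<open>j\<close> ranging over
  finite types \<open>'n\<close> and \<open>'m\<close>, where $n =$ \<open>CARD('n)\<close> and $m =$ \<open>CARD('m)\<close>. The space
  $\mathbb R^{n+m}$ is \<open>real ^ ('n + 'm)\<close>, in which $e_v$ is \<open>axis v 1\<close>. The sums of sets in
  \<open>Z_polytope\<close> are Minkowski sums.
\<close>

definition Z_polytope :: "(real ^ ('n::finite + 'm::finite)) set" where
  "Z_polytope =
     (\<Sum>i\<in>(UNIV :: 'n set). \<Sum>j\<in>(UNIV :: 'm set). closed_segment (axis (Inl i) 1) (axis (Inr j) 1))"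

definition P_polytope :: "(real ^ ('n::finite + 'm::finite)) set" where
  "P_polytope = Z_polytope \<inter>
     {x. (\<Sum>j\<in>(UNIV :: 'm set). x $ Inr j) \<le> real CARD('n) * real CARD('m) - 1}"

definition Q_polytope :: "(real ^ ('n::finite + 'm::finite)) set" where
  "Q_polytope = P_polytope \<inter>
     {x. (\<Sum>i\<in>(UNIV :: 'n set). x $ Inl i) \<le> real CARD('n) * real CARD('m) - 1}"

text \<open>Outer normal cones; taking inner ones instead would negate every cone of the normal fan and
  yield the same notion of normal equivalence.\<close>

definition normal_cone :: "'a::euclidean_space set \<Rightarrow> 'a set \<Rightarrow> 'a set" where
  "normal_cone P F = {c. \<forall>x\<in>F. \<forall>y\<in>P. c \<bullet> y \<le> c \<bullet> x}"

definition normal_fan :: "'a::euclidean_space set \<Rightarrow> 'a set set" where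
  "normal_fan P = {normal_cone P F | F. F face_of P \<and> F \<noteq> {}}"

definition normally_equivalent :: "'a::euclidean_space set \<Rightarrow> 'a set \<Rightarrow> bool" where
  "normally_equivalent P Q \<longleftrightarrow> polytope P \<and> polytope Q \<and> normal_fan P = normal_fan Q"

text \<open>A matroid is given by its finite ground set and its collection of bases.\<close>

definition matroid :: "'s set \<Rightarrow> 's set set \<Rightarrow> bool" where
  "matroid S \<B> \<longleftrightarrow> finite S \<and> \<B> \<subseteq> Pow S \<and> \<B> \<noteq> {} \<and>
     (\<forall>A\<in>\<B>. \<forall>B\<in>\<B>. \<forall>x\<in>A - B. \<exists>y\<in>B - A. insert y (A - {x}) \<in> \<B>)"

definition matroid_polytope :: "'s::finite set set \<Rightarrow> (real ^ 's) set" where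
  "matroid_polytope \<B> = convex hull ((\<lambda>B. \<Sum>v\<in>B. axis v 1) ` \<B>)"

end

theory Submission
  imports Defs
begin

text \<open>
  If $R$ and $M$ have the same normal fan, every vertex of $R$ has a corresponding vertex of $M$, and
  adjacent vertices of $R$ correspond to vertices of $M$ that differ by a positive multiple of the edge
  direction. The vertices of $\mathsf Z_{n,m}$ are the in-degree vectors of acyclic orientations of
  $K_{n,m}$, which are induced by height functions on the nodes. Lowering one node $a$ past two nodes
  $b_2, b_1$ in turn gives a path of two edges along which the coordinate $x_a$ drops twice. A matroid
  polytope has only $0/1$ vertices, so its fan admits no such path. In $\mathsf P_{n,m}$ and
  $\mathsf Q_{n,m}$ such a path survives the truncation as soon as the remaining nodes provide arcs
  with the required fixed orientations. In the remaining cases $n = 1$, and the polytope is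
  the translate by $e_{a_1}$ of the polytope of a uniform matroid, possibly with loops.
\<close>

subsection \<open>Normal fans\<close>

lemma normal_fan_translation:
  fixes P :: "'a::euclidean_space set"
  shows "normal_fan ((+) a ` P) = normal_fan P"
proof -
  have cone: "normal_cone ((+) a ` P) ((+) a ` F) = normal_cone P F" for F
    by (auto simp: normal_cone_def inner_add_right)
  have "normal_fan P \<subseteq> normal_fan ((+) a ` P)"
    unfolding normal_fan_def using cone by clarify (metis face_of_translation_eq image_is_empty)
  moreover have "normal_fan ((+) a ` P) \<subseteq> normal_fan P"
  proof
    fix N assume "N \<in> normal_fan ((+) a ` P)"
    then obtain F where F: "F face_of (+) a ` P" "F \<noteq> {}" "N = normal_cone ((+) a ` P) F"
      by (auto simp: normal_fan_def)
    then obtain G where "F = (+) a ` G"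
      by (meson face_of_imp_subset subset_imageE)
    with F cone show "N \<in> normal_fan P"
      by (auto simp: normal_fan_def)
  qed
  ultimately show ?thesis by blast
qed

lemma normally_equivalent_translation:
  fixes P :: "'a::euclidean_space set"
  assumes "polytope P"
  shows "normally_equivalent ((+) a ` P) P"
  using assms by (simp add: normally_equivalent_def normal_fan_translation polytope_translation_eq)

text \<open>The cone at \<open>v\<close> occurs in the fan of \<open>M\<close>, hence belongs to a
  nonempty face \<open>F\<close> of \<open>M\<close>. Passing to an extreme point of
  \<open>F\<close> only enlarges the cone. This transfers a vertex of \<open>P\<close> to one of
  \<open>M\<close>.\<close>

lemma normal_cone_extreme_point:
  fixes P M :: "'a::euclidean_space set"
  assumes M: "polytope M" and fan: "normal_fan P = normal_fan M" and v: "v extreme_point_of P"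
  obtains p where "p extreme_point_of M" "normal_cone P {v} \<subseteq> normal_cone M {p}"
proof -
  have "normal_cone P {v} \<in> normal_fan M"
    using v fan by (metis (mono_tags, lifting) face_of_singleton insert_not_empty mem_Collect_eq normal_fan_def)
  then obtain F where F: "F face_of M" "F \<noteq> {}" "normal_cone P {v} = normal_cone M F"
    by (auto simp: normal_fan_def)
  have "polytope F" using F M face_of_polytope_polytope by blast
  then obtain p where p: "p extreme_point_of F"
    using F(2) extreme_point_exists_convex polytope_imp_compact polytope_imp_convex by metis
  then have "p \<in> F" by (simp add: extreme_point_of_def)
  then have "normal_cone M F \<subseteq> normal_cone M {p}" by (auto simp: normal_cone_def)
  moreover have "p extreme_point_of M" using p F(1) extreme_point_of_face by blast
  ultimately show ?thesis using that F(3) by blast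
qed

text \<open>Injectivity of the transfer of vertices. The cone at \<open>p\<close> is also the cone
  of some nonempty face \<open>G\<close> of \<open>P\<close>. Both \<open>c\<close> and
  \<open>d\<close> attain their maximum over \<open>P\<close> on \<open>G\<close>, and each has a
  single maximizer, so a point of \<open>G\<close> equals both \<open>v\<close> and
  \<open>w\<close>.\<close>

lemma normal_cone_extreme_points_distinct:
  fixes P M :: "'a::euclidean_space set"
  assumes fan: "normal_fan P = normal_fan M" and p: "p extreme_point_of M"
    and v: "normal_cone P {v} \<subseteq> normal_cone M {p}"
    and w: "normal_cone P {w} \<subseteq> normal_cone M {p}"
    and cv: "c \<in> normal_cone P {v}" "\<And>x. x \<in> P \<Longrightarrow> c \<bullet> v \<le> c \<bullet> x \<Longrightarrow> x = v"
    and dw: "d \<in> normal_cone P {w}" "\<And>x. x \<in> P \<Longrightarrow> d \<bullet> w \<le> d \<bullet> x \<Longrightarrow> x = w"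
    and mem: "v \<in> P" "w \<in> P"
  shows "v = w"
proof -
  have "normal_cone M {p} \<in> normal_fan P"
    using p fan by (metis (mono_tags, lifting) face_of_singleton insert_not_empty mem_Collect_eq normal_fan_def)
  then obtain G where G: "G face_of P" "G \<noteq> {}" "normal_cone M {p} = normal_cone P G"
    by (auto simp: normal_fan_def)
  then obtain g where g: "g \<in> G" "g \<in> P" using face_of_imp_subset by blast
  have "c \<in> normal_cone P G" "d \<in> normal_cone P G" using v w cv(1) dw(1) G(3) by blast+
  then have "c \<bullet> v \<le> c \<bullet> g" "d \<bullet> w \<le> d \<bullet> g"
    using g mem unfolding normal_cone_def by blast+
  then show ?thesis using cv(2) dw(2) g(2) by blast
qed

subsection \<open>Uniform matroids\<close>

text \<open>The uniform matroid of rank \<open>k\<close> on \<open>T\<close>, with the elements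
  outside \<open>T\<close> added as loops.\<close>

definition uniform_bases :: "'s set \<Rightarrow> nat \<Rightarrow> 's set set" where
  "uniform_bases T k = {B. B \<subseteq> T \<and> card B = k}"

lemma matroid_uniform_bases:
  fixes T :: "'s::finite set"
  assumes "k \<le> card T"
  shows "matroid UNIV (uniform_bases T k)"
proof -
  have "uniform_bases T k \<noteq> {}"
    using obtain_subset_with_card_n[OF assms] by (auto simp: uniform_bases_def)
  moreover have "\<exists>y\<in>B - A. insert y (A - {x}) \<in> uniform_bases T k"
    if "A \<in> uniform_bases T k" "B \<in> uniform_bases T k" "x \<in> A - B" for A B x
  proof -
    have "card A = k" "card B = k" and sub: "A \<subseteq> T" "B \<subseteq> T"
      using that by (auto simp: uniform_bases_def)
    then have "\<not> B \<subseteq> A" using that(3) card_subset_eq[of A B] by auto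
    then obtain y where y: "y \<in> B - A" by blast
    have "card (insert y (A - {x})) = k"
      using y that(3) \<open>card A = k\<close> card_Suc_Diff1[of A x] by simp
    then show ?thesis using y sub by (auto simp: uniform_bases_def)
  qed
  ultimately show ?thesis by (auto simp: matroid_def)
qed

lemma polytope_matroid_polytope: "polytope (matroid_polytope \<B>)"
  by (auto simp: matroid_polytope_def intro: polytope_convex_hull)

lemma sum_axis_nth: "(\<Sum>u\<in>B. axis u (1::real) $ v) = of_bool (v \<in> B)"
  for B :: "'s::finite set"
  by (simp add: axis_def)

lemma extreme_point_matroid_polytope:
  assumes "p extreme_point_of matroid_polytope \<B>"
  shows "p $ v \<in> {0, 1}"
proof -
  obtain B where "p = (\<Sum>u\<in>B. axis u 1)"
    using extreme_point_of_convex_hull[OF assms[unfolded matroid_polytope_def]] by blast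
  then show ?thesis by (simp add: sum_axis_nth)
qed

text \<open>This is the hypersimplex. By Krein-Milman it suffices that the extreme points of the
  right-hand side are 0/1 vectors; two fractional coordinates would allow moving mass between them
  in both directions.\<close>

lemma matroid_polytope_uniform:
  fixes T :: "'s::finite set"
  shows "matroid_polytope (uniform_bases T k) =
    {x. (\<forall>v. 0 \<le> x $ v \<and> x $ v \<le> 1) \<and> (\<forall>v. v \<notin> T \<longrightarrow> x $ v = 0) \<and> (\<Sum>v\<in>UNIV. x $ v) = real k}"
    (is "_ = ?H")
proof -
  let ?V = "(\<lambda>B. \<Sum>v\<in>B. axis v (1::real)) ` uniform_bases T k"
  have sub: "?V \<subseteq> ?H"
    by (auto simp: sum_axis_nth uniform_bases_def)
  have conv: "convex ?H"
  proof (rule convexI)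
    fix x y :: "real ^ 's" and a b :: real
    assume xy: "x \<in> ?H" "y \<in> ?H" and ab: "0 \<le> a" "0 \<le> b" "a + b = 1"
    have "a * x $ v + b * y $ v \<le> 1" for v
      using xy ab convex_bound_le[of "x $ v" 1 "y $ v" a b] by auto
    moreover have "(\<Sum>v\<in>UNIV. a * x $ v + b * y $ v) = real k"
      using xy ab by (simp add: sum.distrib flip: sum_distrib_left distrib_right)
    ultimately show "a *\<^sub>R x + b *\<^sub>R y \<in> ?H"
      using xy ab by auto
  qed
  have "closed ?H"
    by (intro closed_Collect_conj closed_Collect_all closed_Collect_le closed_Collect_imp
        closed_Collect_eq continuous_intros) auto
  moreover have "?H \<subseteq> cbox 0 (\<chi> i. 1)"
    by (auto simp: mem_box_cart)
  ultimately have comp: "compact ?H"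
    using bounded_cbox bounded_subset compact_eq_bounded_closed by blast
  have "y \<in> ?V" if y: "y extreme_point_of ?H" for y
  proof -
    have yH: "y \<in> ?H" using y by (simp add: extreme_point_of_def)
    define B where "B = {v. y $ v = 1}"
    have y01: "y $ u \<in> {0, 1}" for u
    proof (rule ccontr)
      assume u: "y $ u \<notin> {0, 1}"
      \<comment> \<open>The coordinates sum to an integer, so a single one cannot be fractional
        alone.\<close>
      have "\<exists>w. w \<noteq> u \<and> y $ w \<notin> {0, 1}"
      proof (rule ccontr)
        assume "\<not> ?thesis"
        then have "y $ w \<in> \<int>" if "w \<noteq> u" for w using that by force
        then have "(\<Sum>w\<in>UNIV - {u}. y $ w) \<in> \<int>" by (intro Ints_sum) auto
        moreover have "(\<Sum>w\<in>UNIV. y $ w) = y $ u + (\<Sum>w\<in>UNIV - {u}. y $ w)"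
          by (simp add: sum.remove)
        ultimately have "y $ u \<in> \<int>"
          using yH by (metis (mono_tags, lifting) Ints_diff Ints_of_nat add_diff_cancel_right' mem_Collect_eq)
        then obtain i :: int where i: "y $ u = of_int i" by (auto elim: Ints_cases)
        moreover have "0 \<le> y $ u" "y $ u \<le> 1" using yH by auto
        ultimately have "i = 0 \<or> i = 1" by auto
        then show False using i u by auto
      qed
      then obtain w where w: "w \<noteq> u" "y $ w \<notin> {0, 1}" by blast
      have bd: "0 < y $ u" "y $ u < 1" "0 < y $ w" "y $ w < 1"
        using yH u w by (auto simp: less_le)
      \<comment> \<open>The largest amount that can be moved between \<open>u\<close> and
        \<open>w\<close>, either way, with both coordinates staying in the unit interval.\<close>
      define e where "e = Min {y $ u, 1 - y $ u, y $ w, 1 - y $ w}"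
      have e: "0 < e" "e \<le> y $ u" "e \<le> 1 - y $ u" "e \<le> y $ w" "e \<le> 1 - y $ w"
        using bd by (auto simp: e_def)
      define d where "d = e *\<^sub>R (axis u 1 - axis w 1 :: real ^ 's)"
      have dn: "d $ v = (if v = u then e else if v = w then - e else 0)" for v
        using w by (auto simp: d_def axis_def)
      have "(\<Sum>v\<in>UNIV. d $ v) = 0"
        by (simp add: d_def axis_def sum_subtractf flip: sum_distrib_left)
      moreover have "u \<in> T" "w \<in> T" using yH u w by auto
      ultimately have "y + d \<in> ?H" "y - d \<in> ?H"
        using yH e by (auto simp: dn sum.distrib sum_subtractf)
      moreover have "y \<in> open_segment (y + d) (y - d)"
      proof -
        have "midpoint (y + d) (y - d) = y" by (simp add: midpoint_def flip: scaleR_2)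
        moreover have "d $ u \<noteq> 0" using e by (simp add: dn)
        then have "y + d \<noteq> y - d" by (auto simp: vec_eq_iff)
        ultimately show ?thesis by (metis midpoint_in_open_segment)
      qed
      ultimately show False using y by (auto simp: extreme_point_of_def)
    qed
    have "y = (\<Sum>v\<in>B. axis v 1)"
      using y01 by (auto simp: vec_eq_iff sum_axis_nth B_def)
    moreover have "B \<in> uniform_bases T k"
    proof -
      have "(\<Sum>v\<in>UNIV. y $ v) = real (card B)"
        by (subst \<open>y = _\<close>) (simp add: sum_axis_nth)
      then show ?thesis using yH by (auto simp: uniform_bases_def B_def)
    qed
    ultimately show ?thesis by blast
  qed
  then have "convex hull {y. y extreme_point_of ?H} \<subseteq> convex hull ?V"
    by (intro hull_mono) auto
  then have "?H \<subseteq> convex hull ?V"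
    using Krein_Milman_Minkowski[OF comp conv] by simp
  moreover have "convex hull ?V \<subseteq> ?H" using sub conv by (rule hull_minimal)
  ultimately show ?thesis by (simp add: matroid_polytope_def)
qed

subsection \<open>Vertices of the graphical zonotope\<close>

text \<open>\<open>\<sigma> i j\<close> means that the arc between \<open>Inl i\<close> and
  \<open>Inr j\<close> points to \<open>Inl i\<close>. The point is then the in-degree vector of the
  orientation, which need not be acyclic here.\<close>

definition orientation_point :: "('n::finite \<Rightarrow> 'm::finite \<Rightarrow> bool) \<Rightarrow> real ^ ('n + 'm)" where
  "orientation_point \<sigma> = (\<Sum>i\<in>UNIV. \<Sum>j\<in>UNIV. axis (if \<sigma> i j then Inl i else Inr j) 1)"

text \<open>The normal cone of the zonotope at the orientation point, described arc by arc; the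
  strict version below is its interior.\<close>

definition weakly_compatible :: "('n::finite \<Rightarrow> 'm::finite \<Rightarrow> bool) \<Rightarrow> real ^ ('n + 'm) \<Rightarrow> bool" where
  "weakly_compatible \<sigma> c \<longleftrightarrow>
    (\<forall>i j. if \<sigma> i j then c $ Inr j \<le> c $ Inl i else c $ Inl i \<le> c $ Inr j)"

definition strictly_compatible :: "('n::finite \<Rightarrow> 'm::finite \<Rightarrow> bool) \<Rightarrow> real ^ ('n + 'm) \<Rightarrow> bool" where
  "strictly_compatible \<sigma> c \<longleftrightarrow>
    (\<forall>i j. if \<sigma> i j then c $ Inr j < c $ Inl i else c $ Inl i < c $ Inr j)"

lemma strictly_compatible_imp_weakly: "strictly_compatible \<sigma> c \<Longrightarrow> weakly_compatible \<sigma> c"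
  by (auto simp: strictly_compatible_def weakly_compatible_def intro: less_imp_le split: if_splits)

lemma mem_Z_polytope_iff:
  fixes x :: "real ^ ('n::finite + 'm::finite)"
  shows "x \<in> Z_polytope \<longleftrightarrow>
    (\<exists>f. (\<forall>i j. f i j \<in> closed_segment (axis (Inl i) 1) (axis (Inr j) 1)) \<and>
      x = (\<Sum>i\<in>UNIV. \<Sum>j\<in>UNIV. f i j))"
    (is "_ \<longleftrightarrow> ?R")
proof
  assume "x \<in> Z_polytope"
  then obtain g where g: "x = sum g UNIV"
    "\<And>i. g i \<in> (\<Sum>j\<in>UNIV. closed_segment (axis (Inl i) 1) (axis (Inr j) 1))"
    by (auto simp: Z_polytope_def set_sum_alt[of "UNIV :: 'n set"])
  then have "\<exists>h. (\<forall>j. h j \<in> closed_segment (axis (Inl i) 1) (axis (Inr j) 1)) \<and> g i = sum h UNIV" for i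
    using g(2)[of i] by (auto simp: set_sum_alt[of "UNIV :: 'm set"])
  then obtain f where "\<And>i j. f i j \<in> closed_segment (axis (Inl i) 1) (axis (Inr j) 1)"
    "\<And>i. g i = sum (f i) UNIV" by metis
  then show ?R using g(1) by (intro exI[of _ f]) simp
next
  assume ?R
  then show "x \<in> Z_polytope"
    by (auto simp: Z_polytope_def set_sum_alt)
qed

lemma inner_segment_axes_le:
  fixes c :: "real ^ 's::finite"
  assumes "z \<in> closed_segment (axis u 1) (axis v 1)" "c $ v \<le> c $ u"
  shows "c \<bullet> z \<le> c $ u"
proof -
  obtain t where t: "0 \<le> t" "t \<le> 1" "z = (1 - t) *\<^sub>R axis u 1 + t *\<^sub>R axis v 1"
    using assms(1) by (auto simp: in_segment)
  then have "c \<bullet> z = (1 - t) * c $ u + t * c $ v"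
    by (simp add: inner_add_right inner_axis)
  also have "\<dots> \<le> (1 - t) * c $ u + t * c $ u"
    using assms(2) t by (intro add_mono mult_left_mono) auto
  finally show ?thesis by (simp add: algebra_simps)
qed

lemma inner_segment_axes_unique:
  fixes c :: "real ^ 's::finite"
  assumes "z \<in> closed_segment (axis u 1) (axis v 1)" "c $ v < c $ u" "c $ u \<le> c \<bullet> z"
  shows "z = axis u 1"
proof -
  obtain t where t: "0 \<le> t" "t \<le> 1" "z = (1 - t) *\<^sub>R axis u 1 + t *\<^sub>R axis v 1"
    using assms(1) by (auto simp: in_segment)
  then have "c \<bullet> z = (1 - t) * c $ u + t * c $ v"
    by (simp add: inner_add_right inner_axis)
  also have "\<dots> = c $ u - t * (c $ u - c $ v)" by (simp add: algebra_simps)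
  finally have "c \<bullet> z = c $ u - t * (c $ u - c $ v)" .
  then have "t * (c $ u - c $ v) \<le> 0" using assms(3) by simp
  then have "t = 0" using assms(2) t(1) by (simp add: mult_le_0_iff)
  then show ?thesis using t by simp
qed

lemma orientation_point_in_Z: "orientation_point \<sigma> \<in> Z_polytope"
  unfolding mem_Z_polytope_iff orientation_point_def by (intro exI conjI allI refl) auto

lemma inner_orientation_point:
  "c \<bullet> orientation_point \<sigma> = (\<Sum>i\<in>UNIV. \<Sum>j\<in>UNIV. c $ (if \<sigma> i j then Inl i else Inr j))"
  unfolding orientation_point_def by (simp add: inner_sum_right inner_axis)

text \<open>A linear functional on a Minkowski sum is maximized summand by summand, and
  \<open>c\<close> is weakly larger at the head of each arc.\<close>

lemma orientation_point_maximal: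
  assumes c: "weakly_compatible \<sigma> c" and x: "x \<in> Z_polytope"
  shows "c \<bullet> x \<le> c \<bullet> orientation_point \<sigma>"
proof -
  obtain f where f: "\<And>i j. f i j \<in> closed_segment (axis (Inl i) 1) (axis (Inr j) 1)"
    "x = (\<Sum>i\<in>UNIV. \<Sum>j\<in>UNIV. f i j)" using x unfolding mem_Z_polytope_iff by blast
  have "c \<bullet> f i j \<le> c $ (if \<sigma> i j then Inl i else Inr j)" for i j
    using inner_segment_axes_le[of "f i j" "Inl i" "Inr j" c] inner_segment_axes_le[of "f i j" "Inr j" "Inl i" c]
      f(1)[of i j] c
    by (auto simp: closed_segment_commute weakly_compatible_def split: if_splits)
  then show ?thesis
    unfolding inner_orientation_point f(2) inner_sum_right by (intro sum_mono)
qed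

text \<open>The deficits of the single arcs are nonnegative with sum at most zero, so all vanish;
  strictness then pins each summand to the head of its arc.\<close>

lemma orientation_point_unique:
  assumes c: "strictly_compatible \<sigma> c" and x: "x \<in> Z_polytope"
    and le: "c \<bullet> orientation_point \<sigma> \<le> c \<bullet> x"
  shows "x = orientation_point \<sigma>"
proof -
  obtain f where f: "\<And>i j. f i j \<in> closed_segment (axis (Inl i) 1) (axis (Inr j) 1)"
    "x = (\<Sum>i\<in>UNIV. \<Sum>j\<in>UNIV. f i j)" using x unfolding mem_Z_polytope_iff by blast
  let ?h = "\<lambda>i j. if \<sigma> i j then Inl i else Inr j"
  have le1: "c \<bullet> f i j \<le> c $ ?h i j" for i j
    using inner_segment_axes_le[of "f i j" "Inl i" "Inr j" c] inner_segment_axes_le[of "f i j" "Inr j" "Inl i" c]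
      f(1)[of i j] strictly_compatible_imp_weakly[OF c]
    by (auto simp: closed_segment_commute weakly_compatible_def split: if_splits)
  have tot: "(\<Sum>(i, j)\<in>UNIV \<times> UNIV. c $ ?h i j - c \<bullet> f i j) \<le> 0"
    using le unfolding inner_orientation_point f(2) inner_sum_right
    unfolding sum.cartesian_product[symmetric] sum_subtractf by simp
  moreover have "(\<Sum>(i, j)\<in>UNIV \<times> UNIV. c $ ?h i j - c \<bullet> f i j) \<ge> 0"
    using le1 by (intro sum_nonneg) auto
  ultimately have "(\<Sum>(i, j)\<in>UNIV \<times> UNIV. c $ ?h i j - c \<bullet> f i j) = 0" by (rule order_antisym)
  then have "\<forall>z\<in>UNIV \<times> UNIV. (case z of (i, j) \<Rightarrow> c $ ?h i j - c \<bullet> f i j) = 0"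
    using le1 by (subst (asm) sum_nonneg_eq_0_iff) auto
  then have eq: "c $ ?h i j = c \<bullet> f i j" for i j by auto
  have "f i j = axis (?h i j) 1" for i j
  proof (cases "\<sigma> i j")
    case True
    then have "c $ Inr j < c $ Inl i" using c by (metis strictly_compatible_def)
    then show ?thesis
      using f(1)[of i j] True eq[of i j] inner_segment_axes_unique[of "f i j" "Inl i" "Inr j" c]
      by auto
  next
    case False
    then have "c $ Inl i < c $ Inr j" using c by (metis strictly_compatible_def)
    then show ?thesis
      using f(1)[of i j] False eq[of i j] inner_segment_axes_unique[of "f i j" "Inr j" "Inl i" c]
      by (auto simp: closed_segment_commute)
  qed
  then show ?thesis unfolding f(2) orientation_point_def by simp
qed

lemma weakly_compatible_normal_cone:
  assumes "R \<subseteq> Z_polytope" "weakly_compatible \<sigma> c"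
  shows "c \<in> normal_cone R {orientation_point \<sigma>}"
  using assms orientation_point_maximal unfolding normal_cone_def by blast

lemma orientation_point_extreme:
  assumes R: "R \<subseteq> Z_polytope" "convex R" and mem: "orientation_point \<sigma> \<in> R"
    and c: "strictly_compatible \<sigma> c"
  shows "orientation_point \<sigma> extreme_point_of R"
proof -
  have "R \<inter> {x. c \<bullet> x = c \<bullet> orientation_point \<sigma>} = {orientation_point \<sigma>}"
    using R mem orientation_point_unique[OF c] by auto
  moreover have "R \<inter> {x. c \<bullet> x = c \<bullet> orientation_point \<sigma>} face_of R"
    using R orientation_point_maximal[OF strictly_compatible_imp_weakly[OF c]]
    by (intro face_of_Int_supporting_hyperplane_le) auto
  ultimately show ?thesis by (simp add: face_of_singleton)
qed

text \<open>
  The hypotheses make the two orientation points adjacent vertices of \<open>R\<close>: the functionals that are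
  maximal at both span the hyperplane orthogonal to \<open>axis (Inl i0) 1 - axis (Inr j0) 1\<close>, so \<open>p - q\<close>
  is a positive multiple of this vector.
\<close>
lemma flip_coordinate_less:
  fixes R M :: "(real ^ ('n::finite + 'm::finite)) set"
  assumes R: "R \<subseteq> Z_polytope" and fan: "normal_fan R = normal_fan M"
    and flip: "\<sigma> i0 j0" "\<not> \<sigma>' i0 j0" "\<And>i j. (i, j) \<noteq> (i0, j0) \<Longrightarrow> \<sigma>' i j = \<sigma> i j"
    and c0: "(c :: real ^ ('n + 'm)) $ Inl i0 = c $ Inr j0"
    and gap: "\<And>i j. (i, j) \<noteq> (i0, j0) \<Longrightarrow>
      if \<sigma> i j then c $ Inr j + 1 \<le> c $ Inl i else c $ Inl i + 1 \<le> c $ Inr j"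
    and mem: "orientation_point \<sigma> \<in> R" "orientation_point \<sigma>' \<in> R"
    and p: "p extreme_point_of M" "normal_cone R {orientation_point \<sigma>} \<subseteq> normal_cone M {p}"
    and q: "q extreme_point_of M" "normal_cone R {orientation_point \<sigma>'} \<subseteq> normal_cone M {q}"
  shows "q $ Inl i0 < p $ Inl i0"
proof -
  have pM: "p \<in> M" and qM: "q \<in> M" using p q by (auto simp: extreme_point_of_def)
  have le: "b \<bullet> q \<le> b \<bullet> p" if "weakly_compatible \<sigma> b" for b
    using weakly_compatible_normal_cone[OF R that] p(2) qM by (auto simp: normal_cone_def)
  have ge: "b \<bullet> p \<le> b \<bullet> q" if "weakly_compatible \<sigma>' b" for b
    using weakly_compatible_normal_cone[OF R that] q(2) pM by (auto simp: normal_cone_def)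
  have eq: "b \<bullet> p = b \<bullet> q" if "weakly_compatible \<sigma> b" "weakly_compatible \<sigma>' b" for b
    using le ge that by (simp add: order_antisym)
  \<comment> \<open>The gap of 1 on all other arcs absorbs any perturbation with entries between 0
    and 1, so only the tie at \<open>i0\<close>, \<open>j0\<close> restricts
    \<open>b\<close>.\<close>
  have w1: "weakly_compatible \<sigma> (c + b)" if "b $ Inr j0 \<le> b $ Inl i0" "\<And>v. 0 \<le> b $ v" "\<And>v. b $ v \<le> 1" for b
    unfolding weakly_compatible_def
  proof (intro allI)
    fix i j
    show "if \<sigma> i j then (c + b) $ Inr j \<le> (c + b) $ Inl i else (c + b) $ Inl i \<le> (c + b) $ Inr j"
      using gap[of i j] c0 flip(1) that(1) that(2,3)[of "Inl i"] that(2,3)[of "Inr j"]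
      by (cases "(i, j) = (i0, j0)") (auto split: if_splits)
  qed
  have w2: "weakly_compatible \<sigma>' (c + b)" if "b $ Inl i0 \<le> b $ Inr j0" "\<And>v. 0 \<le> b $ v" "\<And>v. b $ v \<le> 1" for b
    unfolding weakly_compatible_def
  proof (intro allI)
    fix i j
    show "if \<sigma>' i j then (c + b) $ Inr j \<le> (c + b) $ Inl i else (c + b) $ Inl i \<le> (c + b) $ Inr j"
      using gap[of i j] c0 flip(2) flip(3)[of i j] that(1) that(2,3)[of "Inl i"] that(2,3)[of "Inr j"]
      by (cases "(i, j) = (i0, j0)") (auto split: if_splits)
  qed
  have e0: "c \<bullet> p = c \<bullet> q"
    using eq[of c] w1[of 0] w2[of 0] by simp
  \<comment> \<open>Functionals compatible with both orientations agree on \<open>p\<close> and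
    \<open>q\<close>. Subtracting the value of \<open>c\<close> isolates one coordinate here and the
    sum of the two remaining ones in \<open>both\<close>.\<close>
  have others: "p $ v = q $ v" if "v \<noteq> Inl i0" "v \<noteq> Inr j0" for v
  proof -
    have "weakly_compatible \<sigma> (c + axis v 1)" "weakly_compatible \<sigma>' (c + axis v 1)"
      using that by (intro w1 w2; simp add: axis_def)+
    from eq[OF this] show ?thesis using e0 by (simp add: inner_add_left inner_axis')
  qed
  have both: "p $ Inl i0 + p $ Inr j0 = q $ Inl i0 + q $ Inr j0"
  proof -
    let ?b = "axis (Inl i0) 1 + axis (Inr j0) 1"
    have "weakly_compatible \<sigma> (c + ?b)" "weakly_compatible \<sigma>' (c + ?b)"
      by (intro w1 w2; simp add: axis_def)+
    from eq[OF this] show ?thesis using e0 by (simp add: inner_add_left inner_axis')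
  qed
  \<comment> \<open>This perturbation breaks the tie in favour of \<open>\<sigma>\<close>, so it
    yields an inequality only.\<close>
  have "q $ Inl i0 \<le> p $ Inl i0"
  proof -
    have "weakly_compatible \<sigma> (c + axis (Inl i0) 1)" by (intro w1; simp add: axis_def)
    from le[OF this] show ?thesis using e0 by (simp add: inner_add_left inner_axis')
  qed
  moreover have "q $ Inl i0 \<noteq> p $ Inl i0"
  proof
    assume "q $ Inl i0 = p $ Inl i0"
    then have pq: "p = q"
      unfolding vec_eq_iff using both others by (metis add_left_cancel)
    \<comment> \<open>Half a unit breaks the tie and is less than the gap, so every arc becomes
      strict; \<open>s2\<close> breaks the tie the other way.\<close>
    have s1: "strictly_compatible \<sigma> (c + (1/2) *\<^sub>R axis (Inl i0) 1)"
      unfolding strictly_compatible_def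
    proof (intro allI)
      fix i j
      show "if \<sigma> i j then (c + (1/2) *\<^sub>R axis (Inl i0) 1) $ Inr j < (c + (1/2) *\<^sub>R axis (Inl i0) 1) $ Inl i
        else (c + (1/2) *\<^sub>R axis (Inl i0) 1) $ Inl i < (c + (1/2) *\<^sub>R axis (Inl i0) 1) $ Inr j"
        using gap[of i j] c0 flip(1)
        by (cases "(i, j) = (i0, j0)") (auto simp: axis_def split: if_splits)
    qed
    have s2: "strictly_compatible \<sigma>' (c + (1/2) *\<^sub>R axis (Inr j0) 1)"
      unfolding strictly_compatible_def
    proof (intro allI)
      fix i j
      show "if \<sigma>' i j then (c + (1/2) *\<^sub>R axis (Inr j0) 1) $ Inr j < (c + (1/2) *\<^sub>R axis (Inr j0) 1) $ Inl i
        else (c + (1/2) *\<^sub>R axis (Inr j0) 1) $ Inl i < (c + (1/2) *\<^sub>R axis (Inr j0) 1) $ Inr j"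
        using gap[of i j] c0 flip(2) flip(3)[of i j]
        by (cases "(i, j) = (i0, j0)") (auto simp: axis_def split: if_splits)
    qed
    have "orientation_point \<sigma> = orientation_point \<sigma>'"
      using R p q mem pq
      by (intro normal_cone_extreme_points_distinct[OF fan p(1) p(2) _
            weakly_compatible_normal_cone[OF R strictly_compatible_imp_weakly[OF s1]] _
            weakly_compatible_normal_cone[OF R strictly_compatible_imp_weakly[OF s2]]])
        (auto intro: orientation_point_unique[OF s1] orientation_point_unique[OF s2])
    \<comment> \<open>This coordinate counts the arcs into \<open>i0\<close>, and the flip loses the
      one from \<open>j0\<close>.\<close>
    moreover have "orientation_point \<sigma> $ Inl i0 \<noteq> orientation_point \<sigma>' $ Inl i0"
    proof -
      have "orientation_point \<sigma>'' $ Inl i0 = (\<Sum>j\<in>UNIV. of_bool (\<sigma>'' i0 j))" for \<sigma>'' :: "'n \<Rightarrow> 'm \<Rightarrow> bool"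
      proof -
        have "axis (if \<sigma>'' i j then Inl i else Inr j) (1::real) $ Inl i0 = (if i = i0 then of_bool (\<sigma>'' i0 j) else 0)" for i j
          by (auto simp: axis_def)
        then show ?thesis
          unfolding orientation_point_def sum_component by (subst sum.swap) simp
      qed
      moreover have "\<sigma>' i0 j \<Longrightarrow> \<sigma> i0 j" for j
        using flip(2) flip(3)[of i0 j] by (cases "j = j0") auto
      then have "(\<Sum>j\<in>UNIV. of_bool (\<sigma>' i0 j)) < (\<Sum>j\<in>UNIV. of_bool (\<sigma> i0 j) :: real)"
        using flip(1,2) by (intro sum_strict_mono_ex1) (auto simp: of_bool_def)
      ultimately show ?thesis by simp
    qed
    ultimately show False by simp
  qed
  ultimately show ?thesis by simp
qed

subsection \<open>Paths on which a coordinate drops twice\<close>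

definition height :: "'n::finite \<Rightarrow> ('m::finite \<Rightarrow> real) \<Rightarrow> real \<Rightarrow> real ^ ('n + 'm)" where
  "height i0 g t = (\<chi> v. case v of Inl i \<Rightarrow> if i = i0 then t else 2 | Inr j \<Rightarrow> g j)"

text \<open>Each arc points to its higher end. Without ties this is the orientation for which
  \<open>height i0 g t\<close> is strictly compatible.\<close>

definition height_orientation :: "'n \<Rightarrow> ('m \<Rightarrow> real) \<Rightarrow> real \<Rightarrow> 'n \<Rightarrow> 'm \<Rightarrow> bool" where
  "height_orientation i0 g t i j \<longleftrightarrow> g j < (if i = i0 then t else 2)"

text \<open>
  As the height \<open>t\<close> of \<open>i0\<close> drops through the values \<open>5, 2, - 1\<close>, it passes below \<open>j2\<close> and then below
  \<open>j1\<close>, and below no other node. The height \<open>2\<close> of the remaining \<open>'n\<close>-nodes separates \<open>j1\<close> from \<open>j2\<close>.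
\<close>
lemma not_normally_equivalent_matroid_polytope:
  fixes R :: "(real ^ ('n::finite + 'm::finite)) set" and g :: "'m \<Rightarrow> real"
  assumes R: "R \<subseteq> Z_polytope"
    and g: "g j1 = 0" "g j2 = 4" "\<And>j. j \<noteq> j1 \<Longrightarrow> j \<noteq> j2 \<Longrightarrow> g j \<in> {- 4, 6}"
    and mem: "\<And>t. t \<in> {5, 2, - 1} \<Longrightarrow> orientation_point (height_orientation i0 g t) \<in> R"
  shows "\<not> normally_equivalent R (matroid_polytope \<B>)"
proof
  let ?M = "matroid_polytope \<B>" and ?\<sigma> = "height_orientation i0 g"
  assume "normally_equivalent R ?M"
  then have poly: "polytope R" "polytope ?M" and fan: "normal_fan R = normal_fan ?M"
    by (auto simp: normally_equivalent_def)
  \<comment> \<open>The values -4 and 6 lie below and above all heights taken by the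
    \<open>'n\<close>-nodes, so the arcs at nodes other than \<open>j1\<close> and \<open>j2\<close>
    never turn.\<close>
  have gj: "g j = 0 \<or> g j = 4 \<or> g j = - 4 \<or> g j = 6" for j
    using g by (cases "j = j1"; cases "j = j2"; auto)
  have "\<exists>p. p extreme_point_of ?M \<and> normal_cone R {orientation_point (?\<sigma> t)} \<subseteq> normal_cone ?M {p}"
    if "t \<in> {5, 2, - 1}" for t
  proof -
    have "strictly_compatible (?\<sigma> t) (height i0 g t)"
      unfolding strictly_compatible_def
    proof (intro allI)
      fix i j
      show "if ?\<sigma> t i j then height i0 g t $ Inr j < height i0 g t $ Inl i
        else height i0 g t $ Inl i < height i0 g t $ Inr j"
        using gj[of j] that by (auto simp: height_def height_orientation_def)
    qed
    then show ?thesis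
      using normal_cone_extreme_point[OF poly(2) fan] orientation_point_extreme[OF R _ mem[OF that]]
        polytope_imp_convex[OF poly(1)] by metis
  qed
  then obtain p where p: "\<And>t. t \<in> {5, 2, - 1} \<Longrightarrow> p t extreme_point_of ?M"
    "\<And>t. t \<in> {5, 2, - 1} \<Longrightarrow> normal_cone R {orientation_point (?\<sigma> t)} \<subseteq> normal_cone ?M {p t}"
    by metis
  have five: "5 \<in> {5, 2, - 1 :: real}" and two: "2 \<in> {5, 2, - 1 :: real}" and neg: "- 1 \<in> {5, 2, - 1 :: real}"
    by auto
  have "p 2 $ Inl i0 < p 5 $ Inl i0"
  \<comment> \<open>At height 4 the node \<open>i0\<close> is level with \<open>j2\<close>, and all
    other arcs have a gap of at least 1. Height 0 does the same for \<open>j1\<close> below.\<close>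
  proof (rule flip_coordinate_less[where c = "height i0 g 4",
        OF R fan _ _ _ _ _ mem[OF five] mem[OF two] p(1)[OF five] p(2)[OF five] p(1)[OF two] p(2)[OF two]])
    show "?\<sigma> 2 i j = ?\<sigma> 5 i j" if "(i, j) \<noteq> (i0, j2)" for i j
      using g(1,2) g(3)[of j] that by (cases "j = j1"; cases "j = j2") (auto simp: height_orientation_def)
    show "if ?\<sigma> 5 i j then height i0 g 4 $ Inr j + 1 \<le> height i0 g 4 $ Inl i
        else height i0 g 4 $ Inl i + 1 \<le> height i0 g 4 $ Inr j" if "(i, j) \<noteq> (i0, j2)" for i j
      using g(1,2) g(3)[of j] that by (cases "j = j1"; cases "j = j2") (auto simp: height_def height_orientation_def)
  qed (use g(1,2) in \<open>auto simp: height_def height_orientation_def\<close>)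
  moreover have "p (- 1) $ Inl i0 < p 2 $ Inl i0"
  proof (rule flip_coordinate_less[where c = "height i0 g 0",
        OF R fan _ _ _ _ _ mem[OF two] mem[OF neg] p(1)[OF two] p(2)[OF two] p(1)[OF neg] p(2)[OF neg]])
    show "?\<sigma> (- 1) i j = ?\<sigma> 2 i j" if "(i, j) \<noteq> (i0, j1)" for i j
      using g(1,2) g(3)[of j] that by (cases "j = j1"; cases "j = j2") (auto simp: height_orientation_def)
    show "if ?\<sigma> 2 i j then height i0 g 0 $ Inr j + 1 \<le> height i0 g 0 $ Inl i
        else height i0 g 0 $ Inl i + 1 \<le> height i0 g 0 $ Inr j" if "(i, j) \<noteq> (i0, j1)" for i j
      using g(1,2) g(3)[of j] that by (cases "j = j1"; cases "j = j2") (auto simp: height_def height_orientation_def)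
  qed (use g(1,2) in \<open>auto simp: height_def height_orientation_def\<close>)
  \<comment> \<open>Three strictly decreasing values would have to fit into {0, 1}.\<close>
  moreover have "p t $ Inl i0 \<in> {0, 1}" if "t \<in> {5, 2, - 1}" for t
    using extreme_point_matroid_polytope p(1)[OF that] by blast
  from this[OF five] this[OF two] this[OF neg]
  have "p 5 $ Inl i0 \<le> 1" "p (- 1) $ Inl i0 \<ge> 0" "p 2 $ Inl i0 = 0 \<or> p 2 $ Inl i0 = 1" by auto
  ultimately show False by linarith
qed

section \<open>Arc counts and the truncating inequalities\<close>

lemma sum_orientation_point_Inl:
  fixes \<sigma> :: "'n::finite \<Rightarrow> 'm::finite \<Rightarrow> bool"
  shows "(\<Sum>i\<in>UNIV. orientation_point \<sigma> $ Inl i) = real (card {(i, j). \<sigma> i j})"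
proof -
  have "(\<Sum>i'\<in>UNIV. axis (if \<sigma> i j then Inl i else Inr j) (1::real) $ Inl i') = of_bool (\<sigma> i j)" for i j
    by (simp add: axis_def)
  moreover have "(\<Sum>i\<in>UNIV. orientation_point \<sigma> $ Inl i) = (\<Sum>i\<in>UNIV. \<Sum>j\<in>UNIV.
      \<Sum>i'\<in>UNIV. axis (if \<sigma> i j then Inl i else Inr j) (1::real) $ Inl i')"
    unfolding orientation_point_def sum_component by (subst sum.swap, subst (2) sum.swap) simp
  ultimately have "(\<Sum>i\<in>UNIV. orientation_point \<sigma> $ Inl i) = (\<Sum>i\<in>UNIV. \<Sum>j\<in>UNIV. of_bool (\<sigma> i j))"
    by simp
  also have "\<dots> = (\<Sum>(i, j)\<in>UNIV \<times> UNIV. of_bool (\<sigma> i j))"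
    by (rule sum.cartesian_product)
  also have "\<dots> = real (card {(i, j). \<sigma> i j})"
    by (simp add: case_prod_unfold)
  finally show ?thesis .
qed

lemma sum_orientation_point:
  fixes \<sigma> :: "'n::finite \<Rightarrow> 'm::finite \<Rightarrow> bool"
  shows "(\<Sum>i\<in>UNIV. orientation_point \<sigma> $ Inl i) + (\<Sum>j\<in>UNIV. orientation_point \<sigma> $ Inr j)
    = real CARD('n) * real CARD('m)"
proof -
  have "(\<Sum>v\<in>UNIV. orientation_point \<sigma> $ v) = (\<Sum>i\<in>UNIV. \<Sum>j\<in>UNIV. \<Sum>v\<in>UNIV.
      axis (if \<sigma> i j then Inl i else Inr j) (1::real) $ v)"
    unfolding orientation_point_def sum_component by (subst sum.swap, subst (2) sum.swap) simp
  also have "\<dots> = real CARD('n) * real CARD('m)"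
    by (simp add: axis_def)
  finally show ?thesis
    by (simp add: UNIV_Plus_UNIV[symmetric] sum.Plus del: UNIV_Plus_UNIV)
qed

lemma card_relation_le_pred:
  fixes \<sigma> :: "'n::finite \<Rightarrow> 'm::finite \<Rightarrow> bool"
  assumes "\<not> \<sigma> i j"
  shows "real (card {(i, j). \<sigma> i j}) \<le> real CARD('n) * real CARD('m) - 1"
proof -
  have "{(i, j). \<sigma> i j} \<subset> (UNIV :: ('n \<times> 'm) set)" using assms by auto
  then have "card {(i, j). \<sigma> i j} < CARD('n \<times> 'm)" by (intro psubset_card_mono) auto
  then have "card {(i, j). \<sigma> i j} + 1 \<le> CARD('n) * CARD('m)" by simp
  then show ?thesis by (metis add_le_imp_le_diff of_nat_1 of_nat_add of_nat_le_iff of_nat_mult)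
qed

text \<open>All coordinates sum to nm, so among orientation points the inequality of
  \<open>P_polytope\<close> removes only the one with every arc pointing to a
  \<open>'m\<close>-node. For \<open>Q_polytope\<close> below, the opposite one is removed
  too.\<close>

lemma orientation_point_in_P:
  assumes "\<sigma> i j"
  shows "orientation_point \<sigma> \<in> P_polytope"
proof -
  have "{(i, j). \<sigma> i j} \<noteq> {}" using assms by auto
  then have "1 \<le> real (card {(i, j). \<sigma> i j})" by (simp add: Suc_le_eq card_gt_0_iff)
  then show ?thesis
    using orientation_point_in_Z[of \<sigma>] sum_orientation_point[of \<sigma>] sum_orientation_point_Inl[of \<sigma>]
    by (simp add: P_polytope_def)
qed

lemma orientation_point_in_Q:
  assumes "\<sigma> i j" "\<not> \<sigma> i' j'"
  shows "orientation_point \<sigma> \<in> Q_polytope"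
  using orientation_point_in_P[of \<sigma>] assms card_relation_le_pred[of \<sigma> i' j'] sum_orientation_point_Inl[of \<sigma>]
  by (simp add: Q_polytope_def)

lemma P_subset_Z: "P_polytope \<subseteq> Z_polytope" and Q_subset_P: "Q_polytope \<subseteq> P_polytope"
  by (auto simp: P_polytope_def Q_polytope_def)

section \<open>Exclusion of the large parameters\<close>

lemma obtain_inj_on_lessThan:
  assumes "k \<le> CARD('a::finite)"
  obtains f :: "nat \<Rightarrow> 'a::finite" where "inj_on f {..<k}"
proof -
  obtain T :: "'a set" where "card T = k" by (rule obtain_subset_with_card_n[OF assms])
  then obtain f where "bij_betw f {..<k} T"
    using finite_same_card_bij[of "{..<k}" T] by auto
  then show ?thesis using that bij_betw_imp_inj_on by blast
qed

text \<open>A second \<open>'n\<close>-node \<open>i 1\<close> stays at height 2 between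
  \<open>j 0\<close> and \<open>j 1\<close>. Its two arcs point in opposite senses for every
  \<open>t\<close>, which keeps the whole path in both polytopes.\<close>

lemma P_Q_not_matroid_of_two_le:
  fixes \<B> :: "('n::finite + 'm::finite) set set"
  assumes "2 \<le> CARD('n)" "2 \<le> CARD('m)"
  shows "\<not> normally_equivalent P_polytope (matroid_polytope \<B>)"
    and "\<not> normally_equivalent Q_polytope (matroid_polytope \<B>)"
proof -
  obtain i :: "nat \<Rightarrow> 'n" where i: "inj_on i {..<2}" using obtain_inj_on_lessThan[OF assms(1)] .
  obtain j :: "nat \<Rightarrow> 'm" where j: "inj_on j {..<2}" using obtain_inj_on_lessThan[OF assms(2)] .
  have i01: "i 1 \<noteq> i 0" and j01: "j 1 \<noteq> j 0"
    using inj_onD[OF i, of 1 0] inj_onD[OF j, of 1 0] by auto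
  define g :: "'m \<Rightarrow> real" where "g k = (if k = j 0 then 0 else if k = j 1 then 4 else 6)" for k
  have "height_orientation (i 0) g t (i 1) (j 0)" "\<not> height_orientation (i 0) g t (i 1) (j 1)" for t
    using i01 j01 by (auto simp: height_orientation_def g_def)
  then have Q: "orientation_point (height_orientation (i 0) g t) \<in> Q_polytope" for t
    by (rule orientation_point_in_Q)
  show "\<not> normally_equivalent P_polytope (matroid_polytope \<B>)"
    using j01 Q Q_subset_P P_subset_Z
    by (intro not_normally_equivalent_matroid_polytope[where g = g and ?j1.0 = "j 0" and ?j2.0 = "j 1" and ?i0.0 = "i 0"])
      (auto simp: g_def)
  show "\<not> normally_equivalent Q_polytope (matroid_polytope \<B>)"
    using j01 Q Q_subset_P P_subset_Z
    by (intro not_normally_equivalent_matroid_polytope[where g = g and ?j1.0 = "j 0" and ?j2.0 = "j 1" and ?i0.0 = "i 0"])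
      (auto simp: g_def)
qed

text \<open>A third node \<open>j 2\<close> at height -4 always sends its arc into
  \<open>i0\<close>, so the path avoids the truncated vertex even when \<open>i0\<close> is the only
  \<open>'n\<close>-node.\<close>

lemma P_not_matroid_of_three_le:
  fixes \<B> :: "('n::finite + 'm::finite) set set"
  assumes "3 \<le> CARD('m)"
  shows "\<not> normally_equivalent P_polytope (matroid_polytope \<B>)"
proof -
  obtain j :: "nat \<Rightarrow> 'm" where j: "inj_on j {..<3}" using obtain_inj_on_lessThan[OF assms] .
  have j012: "j 1 \<noteq> j 0" "j 2 \<noteq> j 0" "j 2 \<noteq> j 1"
    using inj_onD[OF j, of 1 0] inj_onD[OF j, of 2 0] inj_onD[OF j, of 2 1] by auto
  define g :: "'m \<Rightarrow> real" where "g k = (if k = j 0 then 0 else if k = j 1 then 4 else - 4)" for k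
  fix i0 :: 'n
  have \<sigma>: "height_orientation i0 g t i0 (j 2)" if "t \<in> {5, 2, - 1}" for t
    using j012 that by (auto simp: height_orientation_def g_def)
  have "orientation_point (height_orientation i0 g t) \<in> P_polytope" if "t \<in> {5, 2, - 1}" for t
    by (rule orientation_point_in_P) (rule \<sigma>[OF that])
  then show ?thesis
    using j012 P_subset_Z
    by (intro not_normally_equivalent_matroid_polytope[where g = g and ?j1.0 = "j 0" and ?j2.0 = "j 1" and ?i0.0 = i0])
      (auto simp: g_def)
qed

text \<open>Both truncations must be avoided by arcs at \<open>i0\<close> itself: \<open>j 2\<close>
  at height -4 serves the first, \<open>j 3\<close> at height 6 the second.\<close>

lemma Q_not_matroid_of_four_le:
  fixes \<B> :: "('n::finite + 'm::finite) set set"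
  assumes "4 \<le> CARD('m)"
  shows "\<not> normally_equivalent Q_polytope (matroid_polytope \<B>)"
proof -
  obtain j :: "nat \<Rightarrow> 'm" where j: "inj_on j {..<4}" using obtain_inj_on_lessThan[OF assms] .
  have j0123: "j 1 \<noteq> j 0" "j 2 \<noteq> j 0" "j 2 \<noteq> j 1" "j 3 \<noteq> j 0" "j 3 \<noteq> j 1" "j 3 \<noteq> j 2"
    using inj_onD[OF j, of 1 0] inj_onD[OF j, of 2 0] inj_onD[OF j, of 2 1]
      inj_onD[OF j, of 3 0] inj_onD[OF j, of 3 1] inj_onD[OF j, of 3 2] by auto
  define g :: "'m \<Rightarrow> real"
    where "g k = (if k = j 0 then 0 else if k = j 1 then 4 else if k = j 2 then - 4 else 6)" for k
  fix i0 :: 'n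
  have \<sigma>: "height_orientation i0 g t i0 (j 2)" "\<not> height_orientation i0 g t i0 (j 3)"
    if "t \<in> {5, 2, - 1}" for t
    using j0123 that by (auto simp: height_orientation_def g_def)
  have "orientation_point (height_orientation i0 g t) \<in> Q_polytope" if "t \<in> {5, 2, - 1}" for t
    by (rule orientation_point_in_Q) (rule \<sigma>[OF that])+
  then show ?thesis
    using j0123 P_subset_Z Q_subset_P
    by (intro not_normally_equivalent_matroid_polytope[where g = g and ?j1.0 = "j 0" and ?j2.0 = "j 1" and ?i0.0 = i0])
      (auto simp: g_def)
qed

subsection \<open>Stars\<close>

text \<open>The coordinate at \<open>Inr j\<close> is the parameter along the \<open>j\<close>-th
  segment. These parameters vary independently, and the centre of the star receives the
  rest.\<close>

lemma mem_Z_polytope_star_iff: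
  fixes x :: "real ^ ('n::finite + 'm::finite)"
  assumes n: "UNIV = {i0 :: 'n}"
  shows "x \<in> Z_polytope \<longleftrightarrow>
    (\<forall>j. 0 \<le> x $ Inr j \<and> x $ Inr j \<le> 1) \<and> x $ Inl i0 + (\<Sum>j\<in>UNIV. x $ Inr j) = real CARD('m)"
    (is "_ \<longleftrightarrow> ?R")
proof -
  let ?a = "axis (Inl i0) 1 :: real ^ ('n + 'm)" and ?b = "\<lambda>j. axis (Inr j) 1 :: real ^ ('n + 'm)"
  have Inl_cases: "i = i0" for i :: 'n using n by auto
  have nth: "(\<Sum>j\<in>UNIV. (1 - t j) *\<^sub>R ?a + t j *\<^sub>R ?b j) $ v =
      (case v of Inl i \<Rightarrow> real CARD('m) - sum t UNIV | Inr j \<Rightarrow> t j)" for t :: "'m \<Rightarrow> real" and v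
    by (cases v) (auto simp: axis_def sum_subtractf if_distrib Inl_cases cong: if_cong)
  show ?thesis
  proof
    assume "x \<in> Z_polytope"
    then obtain f where f: "\<And>j. f j \<in> closed_segment ?a (?b j)" "x = (\<Sum>j\<in>UNIV. f j)"
      unfolding mem_Z_polytope_iff n by auto
    have "\<forall>j. \<exists>u. 0 \<le> u \<and> u \<le> 1 \<and> f j = (1 - u) *\<^sub>R ?a + u *\<^sub>R ?b j"
      using f(1) by (auto simp: in_segment)
    then obtain t where t: "\<And>j. 0 \<le> t j" "\<And>j. t j \<le> 1" "\<And>j. f j = (1 - t j) *\<^sub>R ?a + t j *\<^sub>R ?b j"
      by metis
    have "x $ v = (case v of Inl i \<Rightarrow> real CARD('m) - sum t UNIV | Inr j \<Rightarrow> t j)" for v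
      unfolding f(2) t(3) by (rule nth)
    then show ?R using t(1,2) by simp
  next
    assume R: ?R
    let ?f = "\<lambda>j. (1 - x $ Inr j) *\<^sub>R ?a + x $ Inr j *\<^sub>R ?b j"
    have "x = (\<Sum>j\<in>UNIV. ?f j)"
      unfolding vec_eq_iff nth
    proof
      fix v
      show "x $ v = (case v of Inl i \<Rightarrow> real CARD('m) - (\<Sum>j\<in>UNIV. x $ Inr j) | Inr j \<Rightarrow> x $ Inr j)"
        using R Inl_cases by (cases v) (simp_all, metis add_diff_cancel_right')
    qed
    moreover have "?f j \<in> closed_segment (axis (Inl i) 1) (?b j)" for i j
      using R Inl_cases[of i] by (auto simp: in_segment)
    ultimately show "x \<in> Z_polytope"
      unfolding mem_Z_polytope_iff by (intro exI[of _ "\<lambda>_. ?f"]) (simp add: n)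
  qed
qed

text \<open>On a star the truncation in \<open>P_polytope\<close> says that the centre has
  coordinate at least 1, which explains the shift. The total m then becomes rank m - 1.\<close>

lemma translate_uniform_iff:
  fixes T :: "('n::finite + 'm::finite) set"
  assumes n: "UNIV = {i0 :: 'n}"
  shows "x \<in> (+) (axis (Inl i0) 1) ` matroid_polytope (uniform_bases T k) \<longleftrightarrow>
    1 \<le> x $ Inl i0 \<and> x $ Inl i0 \<le> 2 \<and> (Inl i0 \<notin> T \<longrightarrow> x $ Inl i0 = 1) \<and>
    (\<forall>j. 0 \<le> x $ Inr j \<and> x $ Inr j \<le> 1 \<and> (Inr j \<notin> T \<longrightarrow> x $ Inr j = 0)) \<and>
    x $ Inl i0 + (\<Sum>j\<in>UNIV. x $ Inr j) = real k + 1"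
proof -
  have all: "(\<forall>v :: 'n + 'm. Q v) \<longleftrightarrow> Q (Inl i0) \<and> (\<forall>j. Q (Inr j))" for Q
    using n by (metis (full_types) UNIV_I singletonD sum.exhaust)
  have sum: "(\<Sum>v\<in>UNIV. h v) = h (Inl i0) + (\<Sum>j\<in>UNIV. h (Inr j))" for h :: "'n + 'm \<Rightarrow> real"
    unfolding UNIV_Plus_UNIV[symmetric] by (subst sum.Plus) (auto simp: n)
  have "x \<in> (+) (axis (Inl i0) 1) ` S \<longleftrightarrow> x - axis (Inl i0) 1 \<in> S" for S
    by (auto intro: image_eqI[of _ _ "x - axis (Inl i0) 1"])
  then show ?thesis
    unfolding matroid_polytope_uniform mem_Collect_eq all sum by (auto simp: axis_def)
qed

lemma matroid_witness:
  fixes T :: "('n::finite + 'm::finite) set"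
  assumes "R = (+) a ` matroid_polytope (uniform_bases T k)" "k \<le> card T"
  shows "\<exists>\<B>. matroid UNIV \<B> \<and> normally_equivalent R (matroid_polytope \<B>)"
  using assms matroid_uniform_bases normally_equivalent_translation polytope_matroid_polytope by blast

lemma P_star_matroid:
  assumes "CARD('n::finite) = 1" "CARD('m::finite) \<in> {1, 2}"
  shows "\<exists>\<B>. matroid UNIV \<B> \<and>
    normally_equivalent (P_polytope :: (real ^ ('n + 'm)) set) (matroid_polytope \<B>)"
proof -
  obtain i0 where n: "UNIV = {i0 :: 'n}" using assms(1) card_1_singletonE by blast
  show ?thesis
  proof (rule matroid_witness)
    show "(P_polytope :: (real ^ ('n + 'm)) set) =
      (+) (axis (Inl i0) 1) ` matroid_polytope (uniform_bases UNIV (CARD('m) - 1))"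
    proof (rule set_eqI)
      fix x :: "real ^ ('n + 'm)"
      \<comment> \<open>This bounds the centre by m, which is at most 2, the upper bound in the
        translated hypersimplex.\<close>
      have "0 \<le> (\<Sum>j\<in>UNIV. x $ Inr j)" if "\<forall>j. 0 \<le> x $ Inr j"
        using that by (intro sum_nonneg) auto
      then show "x \<in> P_polytope \<longleftrightarrow>
        x \<in> (+) (axis (Inl i0) 1) ` matroid_polytope (uniform_bases UNIV (CARD('m) - 1))"
        unfolding translate_uniform_iff[OF n] P_polytope_def Int_iff mem_Z_polytope_star_iff[OF n]
        using assms by auto
    qed
  qed (use assms in auto)
qed

lemma Q_star_matroid:
  assumes "CARD('n::finite) = 1" "CARD('m::finite) \<in> {2, 3}"
  shows "\<exists>\<B>. matroid UNIV \<B> \<and>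
    normally_equivalent (Q_polytope :: (real ^ ('n + 'm)) set) (matroid_polytope \<B>)"
proof -
  obtain i0 where n: "UNIV = {i0 :: 'n}" using assms(1) card_1_singletonE by blast
  \<comment> \<open>For m = 2 the two truncations force the centre coordinate to be 1, so the centre
    is a loop. For m = 3 they give the interval from 1 to 2, and the matroid is uniform of rank 2 on
    four elements.\<close>
  define T :: "('n + 'm) set" where "T = (if CARD('m) = 2 then range Inr else UNIV)"
  have T: "Inr j \<in> T" "Inl i \<in> T \<longleftrightarrow> CARD('m) \<noteq> 2" for i j by (auto simp: T_def)
  have "card T \<ge> CARD('m) - 1"
    using card_mono[of T "range Inr"] T(1) by (force simp: card_image)
  moreover have "(Q_polytope :: (real ^ ('n + 'm)) set) =
    (+) (axis (Inl i0) 1) ` matroid_polytope (uniform_bases T (CARD('m) - 1))"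
  proof (rule set_eqI)
    fix x :: "real ^ ('n + 'm)"
    have "(\<Sum>i\<in>UNIV. x $ Inl i) = x $ Inl i0" by (simp add: n)
    then show "x \<in> Q_polytope \<longleftrightarrow>
      x \<in> (+) (axis (Inl i0) 1) ` matroid_polytope (uniform_bases T (CARD('m) - 1))"
      unfolding translate_uniform_iff[OF n] Q_polytope_def P_polytope_def Int_iff
        mem_Z_polytope_star_iff[OF n] mem_Collect_eq
      using assms T by auto
  qed
  ultimately show ?thesis by (intro matroid_witness)
qed

theorem theorem3p3p13:
  fixes n m :: nat
  assumes "n = CARD('n::finite)" and "m = CARD('m::finite)"
    and "1 \<le> n" and "n \<le> m"
  shows "((\<exists>\<B>. matroid UNIV \<B> \<and>
            normally_equivalent (P_polytope :: (real ^ ('n + 'm)) set) (matroid_polytope \<B>))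
          \<longleftrightarrow> n = 1 \<and> m \<in> {1, 2}) \<and>
         ((n, m) \<noteq> (1, 1) \<longrightarrow>
          ((\<exists>\<B>. matroid UNIV \<B> \<and>
             normally_equivalent (Q_polytope :: (real ^ ('n + 'm)) set) (matroid_polytope \<B>))
           \<longleftrightarrow> n = 1 \<and> m \<in> {2, 3}))"
proof -
  let ?P = "P_polytope :: (real ^ ('n + 'm)) set" and ?Q = "Q_polytope :: (real ^ ('n + 'm)) set"
  have "(\<exists>\<B>. matroid UNIV \<B> \<and> normally_equivalent ?P (matroid_polytope \<B>)) \<longleftrightarrow> n = 1 \<and> m \<in> {1, 2}"
  proof
    assume P: "\<exists>\<B>. matroid UNIV \<B> \<and> normally_equivalent ?P (matroid_polytope \<B>)"
    then have "\<not> 3 \<le> m" unfolding assms(2) using P_not_matroid_of_three_le by blast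
    moreover have "\<not> (2 \<le> n \<and> 2 \<le> m)" unfolding assms(1,2) using P P_Q_not_matroid_of_two_le(1) by blast
    ultimately show "n = 1 \<and> m \<in> {1, 2}" using assms(3,4) by auto
  next
    assume "n = 1 \<and> m \<in> {1, 2}"
    then show "\<exists>\<B>. matroid UNIV \<B> \<and> normally_equivalent ?P (matroid_polytope \<B>)"
      using assms by (intro P_star_matroid) auto
  qed
  moreover have "(\<exists>\<B>. matroid UNIV \<B> \<and> normally_equivalent ?Q (matroid_polytope \<B>)) \<longleftrightarrow> n = 1 \<and> m \<in> {2, 3}"
    if "(n, m) \<noteq> (1, 1)"
  proof
    assume Q: "\<exists>\<B>. matroid UNIV \<B> \<and> normally_equivalent ?Q (matroid_polytope \<B>)"
    then have "\<not> 4 \<le> m" unfolding assms(2) using Q_not_matroid_of_four_le by blast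
    moreover have "\<not> (2 \<le> n \<and> 2 \<le> m)" unfolding assms(1,2) using Q P_Q_not_matroid_of_two_le(2) by blast
    \<comment> \<open>The pair (1, 1), for which the two truncations leave the empty set, is ruled
      out by \<open>that\<close>.\<close>
    ultimately show "n = 1 \<and> m \<in> {2, 3}" using assms(3,4) that by auto
  next
    assume "n = 1 \<and> m \<in> {2, 3}"
    then show "\<exists>\<B>. matroid UNIV \<B> \<and> normally_equivalent ?Q (matroid_polytope \<B>)"
      using assms by (intro Q_star_matroid) auto
  qed
  ultimately show ?thesis by blast
qed

end
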